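(* Let $d=p+q$ with $p,q\ge1$ integers, and let $\Sigma\in\Gamma(\Sigma_1,\Sigma_2)$ with non-zero $\Sigma_1\in\mathbb{S}^p_{\ge}$ and non-zero $\Sigma_2\in\mathbb{S}^q_{\ge}$. The quasi-Gaussian Wasserstein dependence coefficients $\mathfrak{D}_r=\mathfrak{D}_r(\,\cdot\,;p,q)$ for $r\in\{1,2\}$ satisfy the following properties: (i) $\mathfrak{D}_r(\Sigma)\in[0,1]$, while $\mathfrak{D}_r(\Sigma)=0$ if and only if $\Sigma=\Sigma_0$, where $\Sigma_0=\begin{bmatrix}\Sigma_1&0\\0&\Sigma_2\end{bmatrix}$. (ii) There exists $\Sigma^{(r)}\in\Gamma(\Sigma_1,\Sigma_2)$ such that $\mathfrak{D}_r(\Sigma^{(r)})=1$. (iii) $\mathfrak{D}_r$ is invariant with respect to orthogonal transformations within the first $p$ and the last $q$ coordinates: for orthogonal matrices $O_1$ and $O_2$ of dimensions $p\times p$ and $q\times q$, respectively, we have $\mathfrak{D}_r(O\Sigma O^\top)=\mathfrak{D}_r(\Sigma)$ with $O=\begin{bmatrix}O_1&0\\0&O_2\end{bmatrix}$.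
   Context: $\mathbb{S}^m_{\ge}$ is the set of real symmetric positive semi-definite $m\times m$ matrices. $\Gamma(\Sigma_1,\Sigma_2)$ is the set of all $\Sigma\in\mathbb{S}^{p+q}_{\ge}$ with upper left $p\times p$ diagonal block $\Sigma_1$ and lower right $q\times q$ diagonal block $\Sigma_2$. The squared Bures--Wasserstein distance between $\Sigma,\Xi\in\mathbb{S}^d_\ge$ is $d_W^2(\Sigma,\Xi)=\operatorname{tr}(\Sigma)+\operatorname{tr}(\Xi)-2\operatorname{tr}\bigl((\Sigma^{1/2}\Xi\Sigma^{1/2})^{1/2}\bigr)$, which is the squared 2-Wasserstein distance between $\mathcal{N}_d(0,\Sigma)$ and $\mathcal{N}_d(0,\Xi)$. For $\Sigma\in\Gamma(\Sigma_1,\Sigma_2)$ with $\Sigma_1,\Sigma_2$ non-zero and $\Sigma_0$ the block-diagonal matrix with blocks $\Sigma_1,\Sigma_2$: $$\mathfrak{D}_1(\Sigma;p,q)=\frac{d_W^2(\Sigma,I_d)-d_W^2(\Sigma_1,I_p)-d_W^2(\Sigma_2,I_q)}{\sup_{\tilde\Sigma\in\Gamma(\Sigma_1,\Sigma_2)}d_W^2(\tilde\Sigma,I_d)-d_W^2(\Sigma_1,I_p)-d_W^2(\Sigma_2,I_q)},\qquad \mathfrak{D}_2(\Sigma;p,q)=\frac{d_W^2(\Sigma,\Sigma_0)}{\sup_{\tilde\Sigma\in\Gamma(\Sigma_1,\Sigma_2)}d_W^2(\tilde\Sigma,\Sigma_0)}.$$ *)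

theory Defs
  imports "HOL-Analysis.Analysis"
begin

text \<open>
  The index type of a \<open>d \<times> d\<close> matrix with \<open>d = p + q\<close> is the sum type \<open>'p + 'q\<close>: the
  constructor \<^const>\<open>Inl\<close> selects the first \<open>p\<close> coordinates and \<^const>\<open>Inr\<close> the last \<open>q\<close>.
\<close>

definition psd_mats :: "(real^'n^'n) set" where
  "psd_mats = {A. transpose A = A \<and> (\<forall>x. 0 \<le> x \<bullet> (A *v x))}"

text \<open>Every \<open>A \<in> psd_mats\<close> has exactly one such root; elsewhere the value is unspecified.\<close>

definition msqrt :: "real^'n^'n \<Rightarrow> real^'n^'n" where
  "msqrt A = (THE B. B \<in> psd_mats \<and> B ** B = A)"

definition bw_dist_sq :: "real^'n^'n \<Rightarrow> real^'n^'n \<Rightarrow> real" where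
  "bw_dist_sq A B = trace A + trace B - 2 * trace (msqrt (msqrt A ** B ** msqrt A))"

definition upper_left :: "real^('p::finite+'q::finite)^('p+'q) \<Rightarrow> real^'p^'p" where
  "upper_left S = (\<chi> i j. S $ Inl i $ Inl j)"

definition lower_right :: "real^('p::finite+'q::finite)^('p+'q) \<Rightarrow> real^'q^'q" where
  "lower_right S = (\<chi> i j. S $ Inr i $ Inr j)"

definition block_diag :: "real^'p^'p \<Rightarrow> real^'q^'q \<Rightarrow> real^('p::finite+'q::finite)^('p+'q)" where
  "block_diag A B = (\<chi> i j. case (i, j) of
      (Inl k, Inl l) \<Rightarrow> A $ k $ l
    | (Inr k, Inr l) \<Rightarrow> B $ k $ l
    | _ \<Rightarrow> 0)"

definition couplings :: "real^'p^'p \<Rightarrow> real^'q^'q \<Rightarrow> (real^('p::finite+'q::finite)^('p+'q)) set" where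
  "couplings S1 S2 = {S \<in> psd_mats. upper_left S = S1 \<and> lower_right S = S2}"

text \<open>
  The coefficients are functions of \<open>S\<close> alone: \<open>p\<close> and \<open>q\<close> are read off its type and the two
  marginal covariance matrices off its diagonal blocks. For positive semi-definite marginals the
  set of couplings is non-empty and compact, so the suprema are taken over non-empty bounded sets.
\<close>

definition wdep1 :: "real^('p::finite+'q::finite)^('p+'q) \<Rightarrow> real" where
  "wdep1 S = (let S1 = upper_left S; S2 = lower_right S in
     (bw_dist_sq S (mat 1) - bw_dist_sq S1 (mat 1) - bw_dist_sq S2 (mat 1)) /
     ((SUP T \<in> couplings S1 S2. bw_dist_sq T (mat 1))
        - bw_dist_sq S1 (mat 1) - bw_dist_sq S2 (mat 1)))"

definition wdep2 :: "real^('p::finite+'q::finite)^('p+'q) \<Rightarrow> real" where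
  "wdep2 S = (let S1 = upper_left S; S2 = lower_right S; S0 = block_diag S1 S2 in
     bw_dist_sq S S0 / (SUP T \<in> couplings S1 S2. bw_dist_sq T S0))"

end

theory Submission
  imports Defs
begin

text \<open>Write \<open>\<Sigma>\<^sub>0\<close> for the block-diagonal matrix with blocks \<open>\<Sigma>\<^sub>1\<close>, \<open>\<Sigma>\<^sub>2\<close>. Both coefficients have the
  form \<open>(f \<Sigma> - c) / (sup f - c)\<close>, the supremum being over the couplings of \<open>\<Sigma>\<^sub>1\<close> and \<open>\<Sigma>\<^sub>2\<close>. Such a
  quotient has the values claimed in (i) and (ii) as soon as \<open>f\<close> is continuous on the compact set of
  couplings, \<open>f \<ge> c\<close> there with equality exactly at \<open>\<Sigma>\<^sub>0\<close>, and \<open>\<Sigma>\<^sub>0\<close> is not the only coupling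
  (\<open>normalized_by_maximum\<close>). The work lies in these hypotheses.

  For the first coefficient, \<open>f \<Sigma> - c\<close> is twice
  \<open>tr \<Sigma>\<^sub>1\<^sup>1\<^sup>/\<^sup>2 + tr \<Sigma>\<^sub>2\<^sup>1\<^sup>/\<^sup>2 - tr \<Sigma>\<^sup>1\<^sup>/\<^sup>2\<close>. If \<open>\<Sigma>\<^sup>1\<^sup>/\<^sup>2\<close> has diagonal blocks \<open>a\<close>, \<open>e\<close> and off-diagonal block
  \<open>b\<close>, then \<open>\<Sigma>\<^sub>1 = a\<^sup>2 + b b\<^sup>T\<close> dominates \<open>a\<^sup>2\<close>, and operator monotonicity of the square root
  (\<open>psd_diff_if_square_diff\<close>) gives \<open>\<Sigma>\<^sub>1\<^sup>1\<^sup>/\<^sup>2 \<ge> a\<close>; likewise \<open>\<Sigma>\<^sub>2\<^sup>1\<^sup>/\<^sup>2 \<ge> e\<close>. Equal traces force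
  equality of the matrices, hence \<open>b = 0\<close> (\<open>trace_msqrt_eq_blocks_iff\<close>).

  For the second coefficient, \<open>c = 0\<close> and the claim is that the squared distance is non-negative and
  vanishes only if both arguments agree. A polar decomposition of \<open>B\<^sup>1\<^sup>/\<^sup>2 A\<^sup>1\<^sup>/\<^sup>2\<close> exhibits the squared
  distance of \<open>A\<close> and \<open>B\<close> as a sum of two squared Frobenius norms (\<open>bw_dist_sq_sum_of_squares\<close>).

  Continuity holds because squaring is a continuous bijection of the positive semi-definite matrices
  and a bound on the trace of \<open>B\<^sup>2\<close> is a bound on the norm of \<open>B\<close>: on compact sets the inverse of
  squaring is continuous (\<open>continuous_on_msqrt\<close>). A coupling other than \<open>\<Sigma>\<^sub>0\<close> exists because both
  marginals are non-zero (\<open>dependent_coupling_exists\<close>).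

  Invariance (iii) holds because conjugation by an orthogonal matrix preserves the distance, and
  conjugation by a block-diagonal orthogonal matrix maps the couplings of the old marginals onto those of the new
  ones.\<close>

section \<open>Matrix algebra\<close>

lemma matrix_diff_ldistrib: "A ** (B - C) = A ** B - A ** (C :: real^'n^'m)"
  by (simp add: vec_eq_iff matrix_matrix_mult_def right_diff_distrib sum_subtractf)

lemma matrix_diff_rdistrib: "(B - C) ** A = B ** A - (C :: real^'n^'m) ** A"
  by (simp add: vec_eq_iff matrix_matrix_mult_def left_diff_distrib sum_subtractf)

lemma transpose_diff: "transpose (A - B) = transpose A - transpose (B :: real^'n^'m)"
  by (simp add: vec_eq_iff transpose_def)

lemma trace_transpose: "trace (transpose A) = trace (A :: real^'n^'n)"
  by (simp add: trace_def transpose_def)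

text \<open>The norm of \<open>real^'n^'m\<close> is the Frobenius norm.\<close>

lemma inner_matrix_eq_trace: "A \<bullet> B = trace (transpose A ** (B :: real^'n^'m))"
  unfolding trace_def transpose_def matrix_matrix_mult_def inner_vec_def
  by (simp, rule sum.swap)

lemma inner_transpose_mult: "(transpose A *v x) \<bullet> y = x \<bullet> ((A :: real^'n^'m) *v y)"
  by (simp add: dot_lmul_matrix)

lemma inner_symmetric_mult:
  "transpose A = A \<Longrightarrow> (A *v x) \<bullet> y = x \<bullet> ((A :: real^'n^'n) *v y)"
  using inner_transpose_mult[of A x y] by simp

lemma trace_orthogonal_conj:
  "orthogonal_matrix U \<Longrightarrow> trace (U ** A ** transpose U) = trace (A :: real^'n^'n)"
  by (simp add: trace_mul_sym[of _ "transpose U"] matrix_mul_assoc orthogonal_matrix)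

lemma orthogonal_conj_mult:
  assumes "orthogonal_matrix (U :: real^'n^'n)"
  shows "(U ** A ** transpose U) ** (U ** B ** transpose U) = U ** (A ** B) ** transpose U"
proof -
  have "(U ** A ** transpose U) ** (U ** B ** transpose U)
      = U ** A ** (transpose U ** U) ** B ** transpose U"
    by (simp only: matrix_mul_assoc)
  then show ?thesis
    unfolding assms[unfolded orthogonal_matrix] by (simp add: matrix_mul_assoc)
qed

lemma orthogonal_conj_cancel:
  assumes "orthogonal_matrix (U :: real^'n^'n)"
  shows "transpose U ** (U ** A ** transpose U) ** U = A"
proof -
  have "transpose U ** (U ** A ** transpose U) ** U
      = (transpose U ** U) ** A ** (transpose U ** U)"
    by (simp only: matrix_mul_assoc)
  then show ?thesis
    unfolding assms[unfolded orthogonal_matrix] by simp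
qed

lemma transpose_conj:
  "transpose (C ** A ** transpose C) = C ** transpose A ** transpose (C :: real^'n^'m)"
  by (simp add: matrix_transpose_mul matrix_mul_assoc)

lemma continuous_on_matrix_mult [continuous_intros]:
  fixes f :: "'a::topological_space \<Rightarrow> real^'n^'m" and g :: "'a \<Rightarrow> real^'k^'n"
  assumes "continuous_on X f" "continuous_on X g"
  shows "continuous_on X (\<lambda>x. f x ** g x)"
  unfolding matrix_matrix_mult_def by (intro continuous_intros assms)

lemma continuous_on_trace [continuous_intros]:
  fixes f :: "'a::topological_space \<Rightarrow> real^'n^'n"
  assumes "continuous_on X f"
  shows "continuous_on X (\<lambda>x. trace (f x))"
  unfolding trace_def by (intro continuous_intros assms)

definition diag_mat :: "('n \<Rightarrow> real) \<Rightarrow> real^'n^'n" where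
  "diag_mat d = (\<chi> i j. if i = j then d i else 0)"

lemma diag_mat_mult: "diag_mat d ** diag_mat e = diag_mat (\<lambda>i. d i * e i)"
  by (simp add: diag_mat_def matrix_matrix_mult_def vec_eq_iff mult_delta_left mult_delta_right)

lemma transpose_diag_mat: "transpose (diag_mat d) = diag_mat d"
  by (simp add: diag_mat_def transpose_def vec_eq_iff)

lemma trace_diag_mat: "trace (diag_mat d) = sum d UNIV"
  by (simp add: diag_mat_def trace_def)

lemma diag_mat_mult_vec: "diag_mat d *v x = (\<chi> i. d i * x $ i)"
  by (simp add: diag_mat_def matrix_vector_mult_def vec_eq_iff mult_delta_left)

lemma diag_mat_mult_axis: "diag_mat d *v axis j 1 = d j *\<^sub>R axis j 1"
  by (simp add: diag_mat_mult_vec vec_eq_iff axis_def)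

section \<open>The spectral theorem for symmetric matrices\<close>

text \<open>The quadratic form of \<open>f\<close> attains a maximum on the unit sphere of \<open>S\<close>, and every maximiser is an
  eigenvector.\<close>

lemma Rayleigh_maximum_eigenvector:
  fixes f :: "'a::euclidean_space \<Rightarrow> 'a"
  assumes f: "linear f" and sa: "\<And>x y. f x \<bullet> y = x \<bullet> f y"
    and S: "subspace S" and inv: "\<And>x. x \<in> S \<Longrightarrow> f x \<in> S" and nz: "S \<noteq> {0}"
  shows "\<exists>v\<in>S. \<exists>c. norm v = 1 \<and> f v = c *\<^sub>R v"
proof -
  let ?K = "S \<inter> sphere 0 1"
  have "compact ?K"
    using closed_subspace[OF S] by (simp add: closed_Int_compact)
  moreover have "?K \<noteq> {}"
  proof -
    obtain x where "x \<in> S" "x \<noteq> 0"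
      using nz subspace_0[OF S] by blast
    then have "x /\<^sub>R norm x \<in> ?K"
      by (simp add: subspace_scale[OF S])
    then show ?thesis by blast
  qed
  moreover have "continuous_on ?K (\<lambda>x. x \<bullet> f x)"
    by (intro continuous_intros linear_continuous_on linear_conv_bounded_linear[THEN iffD1] f)
  ultimately obtain v where v: "v \<in> ?K" and max: "\<And>y. y \<in> ?K \<Longrightarrow> y \<bullet> f y \<le> v \<bullet> f v"
    by (meson continuous_attains_sup)
  define c where "c = v \<bullet> f v"
  define w where "w = f v - c *\<^sub>R v"
  have vS: "v \<in> S" and nv: "norm v = 1" and vv: "v \<bullet> v = 1"
    using v by (auto simp: norm_eq_1)
  have wS: "w \<in> S"
    unfolding w_def by (intro subspace_diff[OF S] subspace_scale[OF S] inv vS)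
  have max': "y \<bullet> f y \<le> c * (y \<bullet> y)" if "y \<in> S" for y
  proof (cases "y = 0")
    case False
    have "(y /\<^sub>R norm y) \<bullet> f (y /\<^sub>R norm y) \<le> c"
      unfolding c_def using False that by (intro max) (simp add: subspace_scale[OF S])
    moreover have "(y /\<^sub>R norm y) \<bullet> f (y /\<^sub>R norm y) = (y \<bullet> f y) / (y \<bullet> y)"
      by (simp add: linear_scale[OF f] divide_simps dot_square_norm power2_eq_square)
    ultimately have "(y \<bullet> f y) / (y \<bullet> y) \<le> c" by simp
    then show ?thesis
      using False by (simp add: pos_divide_le_eq)
  qed (simp add: linear_0[OF f])
  \<comment> \<open>Perturbing the maximiser in the direction of the residual \<open>w\<close> gains \<open>2 t |w|\<^sup>2\<close> to first
     order, so the residual vanishes.\<close>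
  have first_order: "2 * t * (w \<bullet> w) \<le> t\<^sup>2 * (c * (w \<bullet> w) - w \<bullet> f w)" for t
  proof -
    have fv: "f v = w + c *\<^sub>R v" by (simp add: w_def)
    have vw: "v \<bullet> w = 0" by (simp add: w_def inner_diff_right vv c_def)
    have vfw: "v \<bullet> f w = w \<bullet> w"
      using sa[of v w] vw by (simp add: fv inner_add_left inner_add_right inner_commute)
    have "v + t *\<^sub>R w \<in> S"
      by (intro subspace_add[OF S] subspace_scale[OF S] vS wS)
    from max'[OF this] show ?thesis
      by (simp add: linear_add[OF f] linear_scale[OF f] fv algebra_simps inner_add_left
          inner_add_right vw vfw vv inner_commute[of w v] power2_eq_square)
  qed
  have "w \<bullet> w = 0"
  proof (rule ccontr)
    assume "w \<bullet> w \<noteq> 0"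
    then have pos: "w \<bullet> w > 0" by (simp add: inner_gt_zero_iff)
    define k where "k = max 1 (c * (w \<bullet> w) - w \<bullet> f w)"
    define t where "t = (w \<bullet> w) / k"
    have k: "k \<ge> 1" "c * (w \<bullet> w) - w \<bullet> f w \<le> k" by (auto simp: k_def)
    have t: "t > 0" using pos k by (simp add: t_def)
    have "2 * t * (w \<bullet> w) \<le> t\<^sup>2 * k"
      using first_order[of t] mult_left_mono[OF k(2), of "t\<^sup>2"] by simp
    also have "t\<^sup>2 * k = t * (w \<bullet> w)"
      using k by (simp add: t_def power2_eq_square)
    finally have "2 * (t * (w \<bullet> w)) \<le> t * (w \<bullet> w)" by simp
    moreover have "t * (w \<bullet> w) > 0" using t pos by simp
    ultimately show False by linarith
  qed
  then have "f v = c *\<^sub>R v" by (simp add: w_def)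
  then show ?thesis using vS nv by blast
qed

text \<open>Split off one eigenvector. Since \<open>f\<close> is self-adjoint, the orthogonal complement of the eigenvector
  in \<open>S\<close> is again invariant and of smaller dimension.\<close>

lemma self_adjoint_eigenbasis:
  fixes f :: "'a::euclidean_space \<Rightarrow> 'a"
  assumes f: "linear f" and sa: "\<And>x y. f x \<bullet> y = x \<bullet> f y"
    and "subspace S" and "\<And>x. x \<in> S \<Longrightarrow> f x \<in> S"
  shows "\<exists>B\<subseteq>S. pairwise orthogonal B \<and> (\<forall>b\<in>B. norm b = 1) \<and> span B = S \<and>
           (\<forall>b\<in>B. \<exists>c. f b = c *\<^sub>R b)"
  using assms(3,4)
proof (induction "dim S" arbitrary: S rule: less_induct)
  case (less S)
  note S = less.prems(1) and inv = less.prems(2)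
  show ?case
  proof (cases "S = {0}")
    case True
    then show ?thesis
      by (intro exI[of _ "{}"]) auto
  next
    case False
    obtain v c where v: "v \<in> S" "norm v = 1" "f v = c *\<^sub>R v"
      using Rayleigh_maximum_eigenvector[OF f sa S inv False] by blast
    have vv: "v \<bullet> v = 1" using v by (simp add: norm_eq_1)
    define S' where "S' = {x \<in> S. v \<bullet> x = 0}"
    have S': "subspace S'"
      using S by (auto simp: S'_def subspace_def inner_add_right)
    have inv': "f x \<in> S'" if "x \<in> S'" for x
      using that inv v(3) sa[of v x] by (auto simp: S'_def)
    have "v \<notin> S'" using vv by (simp add: S'_def)
    then have "S' \<subset> S" using v(1) by (metis (no_types, lifting) S'_def mem_Collect_eq psubsetI subsetI)
    then have "dim S' < dim S"
      using S S' by (metis dim_psubset span_eq_iff)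
    from less.hyps[OF this S' inv'] obtain B where
      B: "B \<subseteq> S'" "pairwise orthogonal B" "\<forall>b\<in>B. norm b = 1" "span B = S'"
        "\<forall>b\<in>B. \<exists>c. f b = c *\<^sub>R b"
      by auto
    have "span (insert v B) = S"
    proof
      show "span (insert v B) \<subseteq> S"
        using v B S by (intro span_minimal) (auto simp: S'_def)
      show "S \<subseteq> span (insert v B)"
      proof
        fix x assume "x \<in> S"
        then have "x - (v \<bullet> x) *\<^sub>R v \<in> span B"
          using v S vv B(4) by (auto simp: S'_def subspace_diff subspace_scale inner_diff_right)
        then show "x \<in> span (insert v B)"
          by (auto simp: span_insert)
      qed
    qed
    moreover have "pairwise orthogonal (insert v B)"
      using B(1,2) by (auto simp: pairwise_insert S'_def orthogonal_def inner_commute)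
    ultimately show ?thesis
      using B v by (intro exI[of _ "insert v B"]) (auto simp: S'_def)
  qed
qed

theorem symmetric_matrix_diagonalization:
  fixes A :: "real^'n^'n"
  assumes A: "transpose A = A"
  obtains V d where "orthogonal_matrix V" "A = V ** diag_mat d ** transpose V"
proof -
  obtain B where B: "pairwise orthogonal B" "\<forall>b\<in>B. norm b = 1" "span B = UNIV"
      "\<forall>b\<in>B. \<exists>c. A *v b = c *\<^sub>R b"
    using self_adjoint_eigenbasis[of "(*v) A" UNIV] inner_symmetric_mult[OF A] by auto
  have "independent B"
    using B(1,2) by (intro pairwise_orthogonal_independent) auto
  then have "card B = CARD('n)" and "finite B"
    using B(3) dim_eq_card[of B UNIV] by (auto simp: independent_imp_finite)
  then obtain b :: "'n \<Rightarrow> real^'n" where b: "bij_betw b UNIV B"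
    by (metis finite_class.finite_UNIV finite_same_card_bij)
  then have bB: "b i \<in> B" for i by (auto simp: bij_betw_def)
  have "\<forall>i. \<exists>c. A *v b i = c *\<^sub>R b i"
    using B(4) bB by blast
  then obtain d where d: "\<And>i. A *v b i = d i *\<^sub>R b i"
    unfolding choice_iff by blast
  define V where "V = (\<chi> i j. b j $ i)"
  have colV: "column j V = b j" for j
    by (simp add: V_def column_def)
  have "b i = b j \<longleftrightarrow> i = j" for i j
    using b by (auto simp: bij_betw_def inj_on_def)
  then have "b i \<bullet> b j = (if i = j then 1 else 0)" for i j
    using B(1,2) bB[of i] bB[of j] unfolding pairwise_def orthogonal_def norm_eq_1 by metis
  then have V: "orthogonal_matrix V"
    by (simp add: orthogonal_matrix matrix_mult_transpose_dot_column colV mat_def)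
  have "A ** V = V ** diag_mat d"
  proof -
    have "(A ** V) $ i $ j = (A *v b j) $ i" for i j
      by (simp add: V_def matrix_matrix_mult_def matrix_vector_mult_def)
    moreover have "(V ** diag_mat d) $ i $ j = d j * b j $ i" for i j
      by (simp add: V_def matrix_matrix_mult_def diag_mat_def mult_delta_right)
    ultimately show ?thesis
      by (simp add: vec_eq_iff d)
  qed
  then have "V ** diag_mat d ** transpose V = A ** (V ** transpose V)"
    by (simp add: matrix_mul_assoc)
  then have "A = V ** diag_mat d ** transpose V"
    using V by (simp add: orthogonal_matrix_def)
  with V show ?thesis by (rule that)
qed

section \<open>Positive semi-definite matrices\<close>

lemma psd_matsD:
  assumes "A \<in> psd_mats"
  shows "transpose A = A" "0 \<le> x \<bullet> (A *v x)"
  using assms by (auto simp: psd_mats_def)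

lemma psd_conj:
  assumes "A \<in> psd_mats"
  shows "C ** A ** transpose C \<in> psd_mats"
proof -
  have "x \<bullet> ((C ** A ** transpose C) *v x) = (transpose C *v x) \<bullet> (A *v (transpose C *v x))" for x
    unfolding inner_transpose_mult by (simp only: matrix_vector_mul_assoc matrix_mul_assoc)
  then show ?thesis
    using psd_matsD[OF assms] by (simp add: psd_mats_def transpose_conj del: transpose_matrix_vector)
qed

lemma psd_0: "0 \<in> psd_mats"
  by (simp add: psd_mats_def transpose_def vec_eq_iff)

lemma psd_mat_1: "mat 1 \<in> psd_mats"
  by (simp add: psd_mats_def)

lemma psd_sandwich:
  assumes "A \<in> psd_mats" "B \<in> psd_mats"
  shows "A ** B ** A \<in> psd_mats"
  using psd_conj[OF assms(2), of A] psd_matsD(1)[OF assms(1)] by simp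

lemma psd_diag_mat_iff: "diag_mat d \<in> psd_mats \<longleftrightarrow> (\<forall>i. 0 \<le> d i)"
proof
  assume "diag_mat d \<in> psd_mats"
  then have "0 \<le> axis i 1 \<bullet> (diag_mat d *v axis i 1)" for i
    by (rule psd_matsD)
  then show "\<forall>i. 0 \<le> d i"
    by (simp add: diag_mat_mult_axis inner_axis_axis)
next
  assume "\<forall>i. 0 \<le> d i"
  then have "0 \<le> x \<bullet> (diag_mat d *v x)" for x
    by (auto simp: diag_mat_mult_vec inner_vec_def mult.left_commute intro!: sum_nonneg)
  then show "diag_mat d \<in> psd_mats"
    by (simp add: psd_mats_def transpose_diag_mat)
qed

theorem psd_diagonalization:
  assumes "A \<in> psd_mats"
  obtains V d where "orthogonal_matrix V" "\<And>i. 0 \<le> d i" "A = V ** diag_mat d ** transpose V"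
proof -
  obtain V d where V: "orthogonal_matrix V" and A: "A = V ** diag_mat d ** transpose V"
    using symmetric_matrix_diagonalization psd_matsD(1)[OF assms] by blast
  have "diag_mat d = transpose V ** A ** V"
    unfolding A by (simp only: orthogonal_conj_cancel[OF V])
  then have "diag_mat d \<in> psd_mats"
    using psd_conj[OF assms, of "transpose V"] by simp
  then show ?thesis
    using V A by (intro that[of V d]) (auto simp: psd_diag_mat_iff)
qed

lemma psd_trace_nonneg:
  assumes "A \<in> psd_mats"
  shows "0 \<le> trace A"
  using psd_diagonalization[OF assms]
  by (metis sum_nonneg trace_diag_mat trace_orthogonal_conj)

lemma psd_trace_eq_0:
  assumes "A \<in> psd_mats" "trace A = 0"
  shows "A = 0"
proof -
  obtain V d where V: "orthogonal_matrix V" and d: "\<And>i. 0 \<le> d i"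
    and A: "A = V ** diag_mat d ** transpose V"
    using psd_diagonalization[OF assms(1)] by blast
  have "sum d UNIV = 0"
    using assms(2) by (simp add: A trace_orthogonal_conj[OF V] trace_diag_mat)
  then have "d i = 0" for i
    using d by (simp add: sum_nonneg_eq_0_iff)
  then have "diag_mat d = 0"
    by (simp add: diag_mat_def vec_eq_iff)
  then show ?thesis
    by (simp add: A matrix_matrix_mult_def vec_eq_iff)
qed

lemma psd_if_eigenvalues_nonneg:
  assumes sym: "transpose A = A"
    and ev: "\<And>v c. A *v v = c *\<^sub>R v \<Longrightarrow> v \<noteq> 0 \<Longrightarrow> 0 \<le> c"
  shows "A \<in> psd_mats"
proof -
  obtain V d where V: "orthogonal_matrix V" and A: "A = V ** diag_mat d ** transpose V"
    using symmetric_matrix_diagonalization[OF sym] by blast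
  have "0 \<le> d j" for j
  proof (rule ev)
    let ?v = "V *v axis j 1"
    have VV: "transpose V ** V = mat 1"
      using V by (simp add: orthogonal_matrix)
    have "A ** V = V ** diag_mat d ** (transpose V ** V)"
      unfolding A by (simp only: matrix_mul_assoc)
    then have "A *v ?v = V *v (diag_mat d *v axis j 1)"
      by (simp add: matrix_vector_mul_assoc VV)
    then show "A *v ?v = d j *\<^sub>R ?v"
      by (simp add: diag_mat_mult_axis matrix_vector_mult_scaleR)
    show "?v \<noteq> 0"
    proof
      assume "?v = 0"
      then have "transpose V *v ?v = 0"
        by (simp only: matrix_vector_mult_0_right)
      then show False
        by (simp only: matrix_vector_mul_assoc VV) (simp add: axis_eq_0_iff)
    qed
  qed
  then show ?thesis
    unfolding A by (intro psd_conj) (simp add: psd_diag_mat_iff)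
qed

text \<open>The square root is operator monotone.  For an eigenvector \<open>v\<close> of \<open>X - Y\<close> with eigenvalue
  \<open>c\<close>, the identity \<open>X\<^sup>2 - Y\<^sup>2 = X (X - Y) + (X - Y) X - (X - Y)\<^sup>2\<close> evaluates the form of
  \<open>X\<^sup>2 - Y\<^sup>2\<close> at \<open>v\<close> to \<open>2 c \<langle>v, X v\<rangle> - c\<^sup>2 |v|\<^sup>2\<close>, which is negative if \<open>c < 0\<close>.\<close>

theorem psd_diff_if_square_diff:
  assumes X: "X \<in> psd_mats" and Y: "Y \<in> psd_mats" and le: "X ** X - Y ** Y \<in> psd_mats"
  shows "X - Y \<in> psd_mats"
proof (rule psd_if_eigenvalues_nonneg)
  show "transpose (X - Y) = X - Y"
    by (simp add: transpose_diff psd_matsD(1)[OF X] psd_matsD(1)[OF Y])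
  fix v c assume ev: "(X - Y) *v v = c *\<^sub>R v" and "v \<noteq> 0"
  show "0 \<le> c"
  proof (rule ccontr)
    assume "\<not> 0 \<le> c"
    have Yv: "Y *v v = X *v v - c *\<^sub>R v"
      using ev by (simp add: matrix_vector_mult_diff_rdistrib algebra_simps)
    have sq: "v \<bullet> ((B ** B) *v v) = (B *v v) \<bullet> (B *v v)" if "B \<in> psd_mats" for B
      using inner_symmetric_mult[OF psd_matsD(1)[OF that]] by (simp flip: matrix_vector_mul_assoc)
    have "0 \<le> v \<bullet> ((X ** X - Y ** Y) *v v)"
      using le by (rule psd_matsD)
    also have "\<dots> = 2 * c * (v \<bullet> (X *v v)) - c\<^sup>2 * (v \<bullet> v)"
      by (simp add: matrix_vector_mult_diff_rdistrib inner_diff_right sq[OF X] sq[OF Y])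
        (simp add: Yv inner_diff_left inner_diff_right inner_commute power2_eq_square)
    also have "\<dots> < 0"
    proof -
      have "c * (v \<bullet> (X *v v)) \<le> 0"
        using \<open>\<not> 0 \<le> c\<close> psd_matsD(2)[OF X, of v] by (simp add: mult_nonpos_nonneg)
      moreover have "c\<^sup>2 * (v \<bullet> v) > 0"
        using \<open>\<not> 0 \<le> c\<close> \<open>v \<noteq> 0\<close> by simp
      ultimately show ?thesis by simp
    qed
    finally show False by simp
  qed
qed

text \<open>Operator monotonicity in both directions makes \<open>B - C\<close> and its negative positive semi-definite.\<close>

lemma psd_root_unique:
  assumes "B \<in> psd_mats" "C \<in> psd_mats" "B ** B = C ** C"
  shows "B = C"
proof -
  have "B - C \<in> psd_mats" "C - B \<in> psd_mats"
    using psd_diff_if_square_diff[OF assms(1,2)] psd_diff_if_square_diff[OF assms(2,1)] assms(3) psd_0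
    by simp_all
  then have "trace (B - C) = 0"
    using psd_trace_nonneg[of "B - C"] psd_trace_nonneg[of "C - B"] by (simp add: trace_sub)
  then show ?thesis
    using psd_trace_eq_0 \<open>B - C \<in> psd_mats\<close> by fastforce
qed

lemma psd_root_exists:
  assumes "A \<in> psd_mats"
  shows "\<exists>B\<in>psd_mats. B ** B = A"
proof -
  obtain V d where V: "orthogonal_matrix V" and d: "\<And>i. 0 \<le> d i"
    and A: "A = V ** diag_mat d ** transpose V"
    using psd_diagonalization[OF assms] by blast
  let ?B = "V ** diag_mat (\<lambda>i. sqrt (d i)) ** transpose V"
  have "?B ** ?B = A"
    using d by (simp add: orthogonal_conj_mult[OF V] diag_mat_mult A)
  moreover have "?B \<in> psd_mats"
    using d by (intro psd_conj) (simp add: psd_diag_mat_iff)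
  ultimately show ?thesis by blast
qed

lemma msqrt_eqI:
  assumes "B \<in> psd_mats" "B ** B = A"
  shows "msqrt A = B"
  unfolding msqrt_def using assms psd_root_unique by (intro the_equality) auto

lemma
  assumes "A \<in> psd_mats"
  shows msqrt_psd: "msqrt A \<in> psd_mats" and msqrt_square: "msqrt A ** msqrt A = A"
proof -
  obtain B where B: "B \<in> psd_mats" "B ** B = A"
    using psd_root_exists[OF assms] by blast
  then have "msqrt A = B"
    by (rule msqrt_eqI)
  with B show "msqrt A \<in> psd_mats" "msqrt A ** msqrt A = A"
    by simp_all
qed

text \<open>Inverting the non-zero eigenvalues yields the Moore--Penrose inverse of \<open>M\<close>. The convention
  \<open>inverse 0 = 0\<close> takes care of the kernel.\<close>

lemma psd_pseudo_inverse:
  assumes "M \<in> psd_mats"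
  obtains N where "transpose N = N" "N ** M = M ** N" "M ** N ** M = M" 
proof -
  obtain V d where V: "orthogonal_matrix V" and A: "M = V ** diag_mat d ** transpose V"
    using psd_diagonalization[OF assms] by blast
  let ?N = "V ** diag_mat (\<lambda>i. inverse (d i)) ** transpose V"
  show ?thesis
  proof (rule that)
    show "transpose ?N = ?N" by (simp add: transpose_conj transpose_diag_mat)
    have "(\<lambda>i. d i * inverse (d i) * d i) = d"
    proof
      show "d i * inverse (d i) * d i = d i" for i
        by (cases "d i = 0") simp_all
    qed
    then show "?N ** M = M ** ?N" "M ** ?N ** M = M"
      by (simp_all add: A orthogonal_conj_mult[OF V] diag_mat_mult mult.commute[of "inverse _"])
  qed
qed

section \<open>The Bures--Wasserstein distance\<close>

text \<open>Let \<open>R\<close>, \<open>Q\<close> be the roots of \<open>A\<close>, \<open>B\<close> and \<open>M\<close> the root of \<open>(Q R)\<^sup>T (Q R) = R B R\<close>. With the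
  pseudo-inverse \<open>N\<close> of \<open>M\<close>, the matrix \<open>U = Q R N\<close> is the partial isometry in the polar
  decomposition of \<open>Q R\<close>, and \<open>U\<^sup>T U\<close> is the projection \<open>P\<close> onto the range of \<open>M\<close>. The trace of \<open>M\<close>
  equals the Frobenius product of \<open>U R\<close> and \<open>Q\<close>, so the squared distance is
  \<open>|U R - Q|\<^sup>2 + |R - P R|\<^sup>2\<close>; the second term is what \<open>U\<close> lacks of being an isometry on the range
  of \<open>R\<close>. If both terms vanish, then \<open>B = Q\<^sup>T Q = R P R = R R = A\<close>.\<close>

theorem bw_dist_sq_sum_of_squares:
  fixes A B :: "real^'n^'n"
  assumes A: "A \<in> psd_mats" and B: "B \<in> psd_mats"
  obtains W Z :: "real^'n^'n"
  where "bw_dist_sq A B = W \<bullet> W + Z \<bullet> Z" "W = 0 \<Longrightarrow> Z = 0 \<Longrightarrow> A = B"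
proof -
  define R where "R = msqrt A"
  define Q where "Q = msqrt B"
  define M where "M = msqrt (R ** B ** R)"
  have R: "R \<in> psd_mats" "R ** R = A" and Q: "Q \<in> psd_mats" "Q ** Q = B"
    using msqrt_psd msqrt_square A B by (simp_all add: R_def Q_def)
  have M: "M \<in> psd_mats" "M ** M = R ** B ** R"
    using msqrt_psd msqrt_square psd_sandwich[OF R(1) B] by (simp_all add: M_def)
  note t = psd_matsD(1)[OF R(1)] psd_matsD(1)[OF Q(1)] psd_matsD(1)[OF M(1)]
  obtain N where N: "transpose N = N" "N ** M = M ** N" "M ** N ** M = M"
    using psd_pseudo_inverse[OF M(1)] by blast
  define P where "P = N ** M"
  define U where "U = Q ** R ** N"
  define W where "W = U ** R - Q"
  define Z where "Z = R - P ** R"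
  have tP: "transpose P = P"
    by (simp add: P_def matrix_transpose_mul t N)
  have PP: "P ** P = P"
  proof -
    have "P ** P = N ** (M ** N ** M)"
      by (simp only: P_def matrix_mul_assoc)
    then show ?thesis by (simp only: N(3) P_def)
  qed
  have tU: "transpose U = N ** R ** Q"
    by (simp add: U_def matrix_transpose_mul t N matrix_mul_assoc)
  have tUQR: "transpose U ** Q ** R = N ** M ** M"
  proof -
    have "transpose U ** Q ** R = N ** (R ** (Q ** Q) ** R)"
      by (simp only: tU matrix_mul_assoc)
    then show ?thesis by (simp only: Q M(2)[symmetric] matrix_mul_assoc)
  qed
  have UU: "transpose U ** U = P"
  proof -
    have "transpose U ** U = (transpose U ** Q ** R) ** N"
      by (simp only: U_def matrix_mul_assoc)
    also have "\<dots> = P ** (M ** N)"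
      by (simp only: tUQR P_def matrix_mul_assoc)
    also have "\<dots> = P ** P"
      by (simp only: N(2)[symmetric] P_def[symmetric])
    finally show ?thesis by (simp only: PP)
  qed
  have trM: "trace (R ** transpose U ** Q) = trace M"
  proof -
    have "trace (R ** transpose U ** Q) = trace (transpose U ** Q ** R)"
      using trace_mul_sym[of R "transpose U ** Q"] by (simp only: matrix_mul_assoc)
    then show ?thesis by (simp only: tUQR N(2,3))
  qed
  have trM': "trace (Q ** U ** R) = trace M"
    using trM trace_transpose[of "Q ** U ** R"] by (simp add: matrix_transpose_mul t matrix_mul_assoc)
  have "W \<bullet> W = trace (R ** P ** R) - 2 * trace M + trace B"
  proof -
    have "transpose W ** W
        = R ** (transpose U ** U) ** R - R ** transpose U ** Q - Q ** U ** R + Q ** Q"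
      by (simp add: W_def transpose_diff matrix_transpose_mul t matrix_diff_ldistrib
          matrix_diff_rdistrib matrix_mul_assoc)
    then show ?thesis
      by (simp only: inner_matrix_eq_trace trace_add trace_sub trM trM' UU Q)
  qed
  moreover have "Z \<bullet> Z = trace A - trace (R ** P ** R)"
  proof -
    have "transpose Z ** Z = R ** R - R ** P ** R - R ** P ** R + R ** (P ** P) ** R"
      by (simp add: Z_def transpose_diff matrix_transpose_mul t tP matrix_diff_ldistrib
          matrix_diff_rdistrib matrix_mul_assoc)
    then show ?thesis
      by (simp only: inner_matrix_eq_trace trace_add trace_sub PP R)
  qed
  ultimately have bw: "bw_dist_sq A B = W \<bullet> W + Z \<bullet> Z"
    by (simp add: bw_dist_sq_def M_def R_def)
  have eq: "A = B" if "W = 0" "Z = 0"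
  proof -
    have "Q = U ** R" "R = P ** R"
      using that by (simp_all add: W_def Z_def)
    have "B = transpose Q ** Q"
      by (simp add: t Q)
    also have "\<dots> = R ** (transpose U ** U) ** R"
      unfolding \<open>Q = U ** R\<close> by (simp only: matrix_transpose_mul t matrix_mul_assoc)
    also have "\<dots> = R ** (P ** R)"
      by (simp only: UU matrix_mul_assoc)
    also have "\<dots> = A"
      using \<open>R = P ** R\<close> R(2) by simp
    finally show "A = B" by simp
  qed
  show ?thesis
    by (rule that[OF bw eq])
qed

corollary bw_dist_sq_nonneg:
  assumes "A \<in> psd_mats" "B \<in> psd_mats"
  shows "0 \<le> bw_dist_sq A B"
  by (rule bw_dist_sq_sum_of_squares[OF assms]) simp

corollary bw_dist_sq_eq_0_iff:
  assumes "A \<in> psd_mats" "B \<in> psd_mats"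
  shows "bw_dist_sq A B = 0 \<longleftrightarrow> A = B"
proof
  assume 0: "bw_dist_sq A B = 0"
  obtain W Z :: "real^'a^'a" where "bw_dist_sq A B = W \<bullet> W + Z \<bullet> Z" and
    eq: "W = 0 \<Longrightarrow> Z = 0 \<Longrightarrow> A = B"
    using bw_dist_sq_sum_of_squares[OF assms] by blast
  then show "A = B"
    using 0 by (simp add: add_nonneg_eq_0_iff)
next
  assume "A = B"
  let ?R = "msqrt A"
  have "?R ** A ** ?R = ?R ** (?R ** ?R) ** ?R"
    by (simp only: msqrt_square[OF assms(1)])
  also have "\<dots> = (?R ** ?R) ** (?R ** ?R)"
    by (simp only: matrix_mul_assoc)
  also have "\<dots> = A ** A"
    by (simp only: msqrt_square[OF assms(1)])
  finally have "msqrt (?R ** A ** ?R) = A"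
    using assms(1) by (intro msqrt_eqI) simp_all
  then show "bw_dist_sq A B = 0"
    by (simp add: bw_dist_sq_def \<open>A = B\<close>[symmetric])
qed

lemma bw_dist_sq_mat_1:
  assumes "A \<in> psd_mats"
  shows "bw_dist_sq A (mat 1 :: real^'n^'n) = trace A + trace (mat 1 :: real^'n^'n) - 2 * trace (msqrt A)"
  using assms by (simp add: bw_dist_sq_def msqrt_square)

lemma msqrt_orthogonal_conj:
  assumes "A \<in> psd_mats" "orthogonal_matrix U"
  shows "msqrt (U ** A ** transpose U) = U ** msqrt A ** transpose U"
  using assms by (intro msqrt_eqI psd_conj) (simp_all add: orthogonal_conj_mult msqrt_psd msqrt_square)

lemma bw_dist_sq_orthogonal_conj:
  assumes "A \<in> psd_mats" "B \<in> psd_mats" "orthogonal_matrix U"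
  shows "bw_dist_sq (U ** A ** transpose U) (U ** B ** transpose U) = bw_dist_sq A B"
proof -
  have "msqrt A ** B ** msqrt A \<in> psd_mats"
    using assms by (intro psd_sandwich msqrt_psd)
  then show ?thesis
    using assms by (simp add: bw_dist_sq_def msqrt_orthogonal_conj orthogonal_conj_mult
        trace_orthogonal_conj)
qed

section \<open>Compactness and continuity\<close>

lemma closed_psd_mats: "closed (psd_mats :: (real^'n^'n) set)"
proof -
  have "closed {A :: real^'n^'n. transpose A = A}"
    unfolding transpose_def by (intro closed_Collect_eq continuous_intros)
  moreover have "closed {A :: real^'n^'n. 0 \<le> x \<bullet> (A *v x)}" for x
    unfolding matrix_vector_mult_def by (intro closed_Collect_le continuous_intros)
  ultimately show ?thesis
    unfolding psd_mats_def by (intro closed_Collect_conj closed_Collect_all)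
qed

text \<open>The roots of \<open>K\<close> form the preimage of \<open>K\<close> under squaring, which is closed, and the squared
  Frobenius norm of a root is the trace of its square.\<close>

lemma compact_msqrt_image:
  fixes K :: "(real^'n^'n) set"
  assumes K: "closed K" "K \<subseteq> psd_mats" and c: "\<And>A. A \<in> K \<Longrightarrow> trace A \<le> c"
  shows "compact (msqrt ` K)"
proof -
  let ?L = "psd_mats \<inter> (\<lambda>B. B ** B) -` K"
  have "msqrt ` K = ?L"
  proof
    show "msqrt ` K \<subseteq> ?L"
      using K(2) by (auto simp: msqrt_psd msqrt_square subset_iff)
    show "?L \<subseteq> msqrt ` K"
    proof
      fix B assume "B \<in> ?L"
      then have "B = msqrt (B ** B)" "B ** B \<in> K"
        using msqrt_eqI[of B] by simp_all
      then show "B \<in> msqrt ` K" by (rule image_eqI)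
    qed
  qed
  moreover have "closed ?L"
    by (intro closed_Int closed_psd_mats closed_vimage K continuous_intros)
  moreover have "norm B \<le> sqrt c" if "B \<in> ?L" for B
  proof -
    have "B \<bullet> B = trace (B ** B)"
      using that psd_matsD(1)[of B] by (simp add: inner_matrix_eq_trace)
    also have "\<dots> \<le> c"
      using that by (intro c) simp
    finally show ?thesis
      by (simp add: norm_eq_sqrt_inner)
  qed
  ultimately show ?thesis
    by (auto simp: compact_eq_bounded_closed intro!: boundedI)
qed

lemma square_msqrt_image:
  assumes "K \<subseteq> psd_mats"
  shows "(\<lambda>B. B ** B) ` msqrt ` K = K"
proof -
  have "msqrt A ** msqrt A = A" if "A \<in> K" for A
    using that assms by (intro msqrt_square) blast
  then show ?thesis
    by (simp add: image_image)
qed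

lemma compact_psd_if_trace_bounded:
  assumes "closed K" "K \<subseteq> psd_mats" "\<And>A. A \<in> K \<Longrightarrow> trace A \<le> c"
  shows "compact K"
proof -
  have "compact ((\<lambda>B. B ** B) ` msqrt ` K)"
    by (intro compact_continuous_image compact_msqrt_image[OF assms] continuous_intros)
  then show ?thesis
    by (simp only: square_msqrt_image[OF assms(2)])
qed

text \<open>The root is the inverse of squaring, an injective continuous map on the compact set of roots of
  \<open>K\<close>.\<close>

lemma continuous_on_msqrt:
  assumes K: "compact K" "K \<subseteq> psd_mats"
  shows "continuous_on K msqrt"
proof -
  have "compact (trace ` K)"
    by (intro compact_continuous_image K continuous_on_trace continuous_on_id)
  then have "bdd_above (trace ` K)"
    by (intro bounded_imp_bdd_above compact_imp_bounded)
  then obtain c where "\<And>A. A \<in> K \<Longrightarrow> trace A \<le> c"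
    by (auto simp: bdd_above_def)
  then have "compact (msqrt ` K)"
    using K by (intro compact_msqrt_image[of K c]) (auto simp: compact_imp_closed)
  then have "continuous_on ((\<lambda>B. B ** B) ` msqrt ` K) msqrt"
    using K(2) by (intro continuous_on_inv continuous_intros) (auto intro!: msqrt_eqI msqrt_psd)
  then show ?thesis
    by (simp only: square_msqrt_image[OF K(2)])
qed

lemma continuous_on_bw_dist_sq:
  assumes K: "compact K" "K \<subseteq> psd_mats" and X: "X \<in> psd_mats"
  shows "continuous_on K (\<lambda>A. bw_dist_sq A X)"
proof -
  let ?g = "\<lambda>A. msqrt A ** X ** msqrt A"
  have g: "continuous_on K ?g"
    by (intro continuous_intros continuous_on_msqrt K)
  moreover have "?g ` K \<subseteq> psd_mats"
    using K(2) X by (auto intro!: psd_sandwich msqrt_psd)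
  ultimately have "continuous_on (?g ` K) msqrt"
    by (intro continuous_on_msqrt compact_continuous_image K)
  then have "continuous_on K (\<lambda>A. msqrt (?g A))"
    using g by (rule continuous_on_compose2) simp
  then show ?thesis
    unfolding bw_dist_sq_def by (intro continuous_intros)
qed

section \<open>Block matrices\<close>

lemma sum_UNIV_sum:
  fixes f :: "'p::finite + 'q::finite \<Rightarrow> 'a::comm_monoid_add"
  shows "sum f UNIV = (\<Sum>i\<in>UNIV. f (Inl i)) + (\<Sum>j\<in>UNIV. f (Inr j))"
  using sum.Plus[of "UNIV :: 'p set" "UNIV :: 'q set" f] by (simp add: o_def)

definition upper_right :: "real^('p::finite+'q::finite)^('p+'q) \<Rightarrow> real^'q^'p" where
  "upper_right S = (\<chi> i j. S $ Inl i $ Inr j)"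

definition block_vec :: "real^'p \<Rightarrow> real^'q \<Rightarrow> real^('p::finite+'q::finite)" where
  "block_vec u w = (\<chi> k. case k of Inl i \<Rightarrow> u $ i | Inr j \<Rightarrow> w $ j)"

lemma block_vec_cases:
  fixes x :: "real^('p::finite+'q::finite)"
  obtains u w where "x = block_vec u w"
proof
  show "x = block_vec (\<chi> i. x $ Inl i) (\<chi> j. x $ Inr j)"
    by (simp add: vec_eq_iff block_vec_def split: sum.split)
qed

lemma forall_sum_type: "(\<forall>k. P k) \<longleftrightarrow> (\<forall>i. P (Inl i)) \<and> (\<forall>j. P (Inr j))"
  by (metis sum.exhaust)

lemma trace_blocks: "trace S = trace (upper_left S) + trace (lower_right S)"
  by (simp add: trace_def sum_UNIV_sum upper_left_def lower_right_def)

lemma symmetric_entry: "transpose S = S \<Longrightarrow> S $ i $ j = S $ j $ i"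
  by (metis transpose_def vec_lambda_beta)

lemma quadratic_form_blocks:
  assumes "transpose S = S"
  shows "block_vec u w \<bullet> (S *v block_vec u w) =
    u \<bullet> (upper_left S *v u) + w \<bullet> (lower_right S *v w) + 2 * (u \<bullet> (upper_right S *v w))"
proof -
  have sym: "S $ Inr j $ Inl i = S $ Inl i $ Inr j" for i j
    using symmetric_entry[OF assms] .
  have "w \<bullet> (transpose (upper_right S) *v u) = u \<bullet> (upper_right S *v w)"
    by (simp only: inner_transpose_mult inner_commute[of w] inner_commute[of "_ *v _" u])
  moreover have "block_vec u w \<bullet> (S *v block_vec u w) =
    u \<bullet> (upper_left S *v u) + w \<bullet> (lower_right S *v w) + u \<bullet> (upper_right S *v w)
      + w \<bullet> (transpose (upper_right S) *v u)"
    unfolding inner_vec_def matrix_vector_mult_def block_vec_def sum_UNIV_sum upper_left_def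
      lower_right_def upper_right_def transpose_def
    by (simp add: sym sum.distrib distrib_left)
  ultimately show ?thesis by simp
qed

lemma psd_blocks_iff:
  "S \<in> psd_mats \<longleftrightarrow> transpose S = S \<and>
    (\<forall>u w. 0 \<le> u \<bullet> (upper_left S *v u) + w \<bullet> (lower_right S *v w) + 2 * (u \<bullet> (upper_right S *v w)))"
  unfolding psd_mats_def mem_Collect_eq
  by (metis block_vec_cases quadratic_form_blocks)

lemma
  assumes "S \<in> psd_mats"
  shows psd_upper_left: "upper_left S \<in> psd_mats"
    and psd_lower_right: "lower_right S \<in> psd_mats"
proof -
  have form: "0 \<le> u \<bullet> (upper_left S *v u) + w \<bullet> (lower_right S *v w) + 2 * (u \<bullet> (upper_right S *v w))"
    for u w
    using assms psd_blocks_iff by blast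
  have sym: "S $ i $ j = S $ j $ i" for i j
    using symmetric_entry psd_matsD(1)[OF assms] .
  show "upper_left S \<in> psd_mats"
    using form[of _ 0] by (simp add: psd_mats_def upper_left_def transpose_def sym)
  show "lower_right S \<in> psd_mats"
    using form[of 0] by (simp add: psd_mats_def lower_right_def transpose_def sym)
qed

lemma block_eqI:
  assumes "transpose S = S" "transpose T = T"
    and "upper_left S = upper_left T" "lower_right S = lower_right T" "upper_right S = upper_right T"
  shows "S = T"
proof -
  have "S $ Inr j $ Inl i = T $ Inr j $ Inl i" for i j
    using assms(5) symmetric_entry[OF assms(1), of "Inr j"] symmetric_entry[OF assms(2), of "Inr j"]
    by (simp add: upper_right_def vec_eq_iff)
  then show ?thesis
    using assms(3-5)
    by (simp add: vec_eq_iff forall_sum_type upper_left_def lower_right_def upper_right_def)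
qed

lemma block_diag_blocks [simp]:
  "upper_left (block_diag A B) = A" "lower_right (block_diag A B) = B"
  "upper_right (block_diag A B) = 0"
  by (simp_all add: vec_eq_iff block_diag_def upper_left_def lower_right_def upper_right_def)

lemma transpose_block_diag: "transpose (block_diag A B) = block_diag (transpose A) (transpose B)"
  by (simp add: vec_eq_iff forall_sum_type block_diag_def transpose_def)

lemma block_diag_mult:
  "block_diag A B ** block_diag C D = block_diag (A ** C) (B ** D)"
  by (simp add: vec_eq_iff forall_sum_type block_diag_def matrix_matrix_mult_def sum_UNIV_sum)

lemma block_diag_mat_1: "block_diag (mat 1) (mat 1) = mat 1"
  by (simp add: vec_eq_iff forall_sum_type block_diag_def mat_def)

lemma psd_block_diag:
  assumes "A \<in> psd_mats" "B \<in> psd_mats"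
  shows "block_diag A B \<in> psd_mats"
  using assms by (simp add: psd_blocks_iff transpose_block_diag psd_matsD)

lemma orthogonal_block_diag:
  assumes "orthogonal_matrix A" "orthogonal_matrix B"
  shows "orthogonal_matrix (block_diag A B)"
  using assms by (simp add: orthogonal_matrix transpose_block_diag block_diag_mult block_diag_mat_1)

lemma blocks_of_block_diag_mult:
  "upper_left (block_diag A B ** S) = A ** upper_left S"
  "lower_right (block_diag A B ** S) = B ** lower_right S"
  "upper_left (S ** block_diag A B) = upper_left S ** A"
  "lower_right (S ** block_diag A B) = lower_right S ** B"
  by (simp_all add: vec_eq_iff block_diag_def matrix_matrix_mult_def sum_UNIV_sum
      upper_left_def lower_right_def)

lemma blocks_of_block_diag_conj:
  "upper_left (block_diag A B ** S ** transpose (block_diag A B)) = A ** upper_left S ** transpose A"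
  "lower_right (block_diag A B ** S ** transpose (block_diag A B)) = B ** lower_right S ** transpose B"
  by (simp_all add: transpose_block_diag blocks_of_block_diag_mult)

lemma symmetric_square_blocks:
  assumes "transpose R = R"
  shows "upper_left (R ** R) = upper_left R ** upper_left R + upper_right R ** transpose (upper_right R)"
    and "lower_right (R ** R) = lower_right R ** lower_right R + transpose (upper_right R) ** upper_right R"
  using symmetric_entry[OF assms, of "Inr _" "Inl _"]
  by (simp_all add: vec_eq_iff matrix_matrix_mult_def sum_UNIV_sum
      upper_left_def lower_right_def upper_right_def transpose_def)

text \<open>The root of the upper left block dominates the upper left block \<open>a\<close> of the root \<open>R\<close> of \<open>S\<close>: the
  squares of the two differ by \<open>b b\<^sup>T\<close>, where \<open>b\<close> is the off-diagonal block of \<open>R\<close>. The same holds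
  for the lower right block with \<open>b\<^sup>T b\<close>. Taking traces gives the inequality; if it is an
  equality, the roots agree with the blocks of \<open>R\<close> and \<open>b\<^sup>T b = 0\<close>.\<close>

theorem
  fixes S :: "real^('p::finite+'q::finite)^('p+'q)"
  assumes S: "S \<in> psd_mats"
  defines "t \<equiv> trace (msqrt (upper_left S)) + trace (msqrt (lower_right S))"
  shows trace_msqrt_le_blocks: "trace (msqrt S) \<le> t"
    and trace_msqrt_eq_blocks_iff: "trace (msqrt S) = t \<longleftrightarrow> S = block_diag (upper_left S) (lower_right S)"
proof -
  let ?R = "msqrt S" and ?X = "msqrt (upper_left S)" and ?Y = "msqrt (lower_right S)"
  let ?a = "upper_left ?R" and ?b = "upper_right ?R" and ?c = "lower_right ?R"
  have R: "?R \<in> psd_mats" "?R ** ?R = S"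
    using msqrt_psd[OF S] msqrt_square[OF S] .
  have ac: "?a \<in> psd_mats" "?c \<in> psd_mats"
    using psd_upper_left[OF R(1)] psd_lower_right[OF R(1)] .
  have XY: "?X \<in> psd_mats" "?X ** ?X = upper_left S" "?Y \<in> psd_mats" "?Y ** ?Y = lower_right S"
    using psd_upper_left[OF S] psd_lower_right[OF S] by (simp_all add: msqrt_psd msqrt_square)
  have X: "?X ** ?X - ?a ** ?a = ?b ** transpose ?b"
    and Y: "?Y ** ?Y - ?c ** ?c = transpose ?b ** ?b"
    unfolding XY
    unfolding symmetric_square_blocks[OF psd_matsD(1)[OF R(1)], unfolded R(2)] by simp_all
  have "?b ** transpose ?b \<in> psd_mats" "transpose ?b ** ?b \<in> psd_mats"
    using psd_conj[OF psd_mat_1, of ?b] psd_conj[OF psd_mat_1, of "transpose ?b"] by simp_all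
  then have psd: "?X - ?a \<in> psd_mats" "?Y - ?c \<in> psd_mats"
    unfolding X[symmetric] Y[symmetric]
    using psd_diff_if_square_diff[OF XY(1) ac(1)] psd_diff_if_square_diff[OF XY(3) ac(2)] by blast+
  have tr: "t - trace ?R = trace (?X - ?a) + trace (?Y - ?c)"
    by (simp add: t_def trace_blocks[of ?R] trace_sub)
  show "trace ?R \<le> t"
    using tr psd_trace_nonneg[OF psd(1)] psd_trace_nonneg[OF psd(2)] by linarith
  show "trace ?R = t \<longleftrightarrow> S = block_diag (upper_left S) (lower_right S)"
  proof
    assume "trace ?R = t"
    then have "trace (?Y - ?c) = 0"
      using tr psd_trace_nonneg[OF psd(1)] psd_trace_nonneg[OF psd(2)] by linarith
    then have "?Y = ?c"
      using psd_trace_eq_0[OF psd(2)] by simp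
    then have "transpose ?b ** ?b = 0"
      unfolding Y[symmetric] by simp
    then have "?b \<bullet> ?b = 0"
      by (simp add: inner_matrix_eq_trace trace_def)
    then have "?b = 0" by simp
    then have "?R = block_diag ?a ?c"
      by (intro block_eqI[OF psd_matsD(1)[OF R(1)] psd_matsD(1)[OF psd_block_diag[OF ac]]]) simp_all
    then have "S = block_diag (?a ** ?a) (?c ** ?c)"
      using R(2) by (metis block_diag_mult)
    then show "S = block_diag (upper_left S) (lower_right S)"
      by (metis block_diag_blocks(1,2))
  next
    assume "S = block_diag (upper_left S) (lower_right S)"
    then have "?R = block_diag ?X ?Y"
      using XY by (intro msqrt_eqI psd_block_diag) (simp_all add: block_diag_mult)
    then show "trace ?R = t"
      by (simp add: t_def trace_blocks[of "block_diag _ _"])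
  qed
qed

section \<open>Couplings\<close>

lemma couplingsD:
  assumes "T \<in> couplings S1 S2"
  shows "T \<in> psd_mats" "upper_left T = S1" "lower_right T = S2"
  using assms by (simp_all add: couplings_def)

lemma compact_couplings: "compact (couplings S1 S2)"
proof (rule compact_psd_if_trace_bounded)
  show "closed (couplings S1 S2)"
    unfolding couplings_def upper_left_def lower_right_def
    by (intro closed_Collect_conj closed_Collect_eq continuous_intros)
      (simp add: closed_psd_mats)
  show "couplings S1 S2 \<subseteq> psd_mats"
    by (auto simp: couplings_def)
  show "trace A \<le> trace S1 + trace S2" if "A \<in> couplings S1 S2" for A
    using that by (simp add: trace_blocks couplings_def)
qed

lemma psd_nonzero_root_column:
  assumes "A \<in> psd_mats" "A \<noteq> 0"
  obtains k where "msqrt A *v axis k 1 \<noteq> 0"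
proof -
  have "\<not> (\<forall>k. msqrt A *v axis k 1 = 0)"
  proof
    assume "\<forall>k. msqrt A *v axis k 1 = 0"
    then have "msqrt A = 0"
      by (simp add: matrix_vector_mult_basis column_def vec_eq_iff)
    then have "A = 0 ** 0"
      using msqrt_square[OF assms(1)] by simp
    then show False
      using assms(2) by (simp add: matrix_matrix_mult_def vec_eq_iff)
  qed
  then show ?thesis using that by blast
qed

text \<open>Fill the off-diagonal block with the rank-one matrix \<open>x y\<^sup>T\<close>, where \<open>x\<close> and \<open>y\<close> are non-zero
  columns of the roots of \<open>S1\<close> and \<open>S2\<close>. By Cauchy--Schwarz the squares of \<open>\<langle>u, x\<rangle>\<close> and
  \<open>\<langle>w, y\<rangle>\<close> are at most \<open>\<langle>u, S1 u\<rangle>\<close> and \<open>\<langle>w, S2 w\<rangle>\<close>, so the form of the resulting matrix at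
  \<open>(u, w)\<close> is at least \<open>(\<langle>u, x\<rangle> + \<langle>w, y\<rangle>)\<^sup>2\<close>.\<close>

lemma dependent_coupling_exists:
  fixes S1 :: "real^'p::finite^'p" and S2 :: "real^'q::finite^'q"
  assumes S1: "S1 \<in> psd_mats" "S1 \<noteq> 0" and S2: "S2 \<in> psd_mats" "S2 \<noteq> 0"
  obtains T where "T \<in> couplings S1 S2" "T \<noteq> block_diag S1 S2"
proof -
  let ?A = "msqrt S1" and ?B = "msqrt S2"
  obtain k where k: "?A *v axis k 1 \<noteq> 0"
    using psd_nonzero_root_column[OF S1] by blast
  obtain l where l: "?B *v axis l 1 \<noteq> 0"
    using psd_nonzero_root_column[OF S2] by blast
  define x where "x = ?A *v axis k 1"
  define y where "y = ?B *v axis l 1"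
  define T :: "real^('p+'q)^('p+'q)" where "T = (\<chi> i j. case (i, j) of
      (Inl i, Inl j) \<Rightarrow> S1 $ i $ j
    | (Inr i, Inr j) \<Rightarrow> S2 $ i $ j
    | (Inl i, Inr j) \<Rightarrow> x $ i * y $ j
    | (Inr i, Inl j) \<Rightarrow> y $ i * x $ j)"
  have blocks: "upper_left T = S1" "lower_right T = S2" "upper_right T = (\<chi> i j. x $ i * y $ j)"
    by (simp_all add: T_def upper_left_def lower_right_def upper_right_def vec_eq_iff)
  have "transpose T = T"
    using psd_matsD(1)[OF S1(1)] psd_matsD(1)[OF S2(1)]
    by (simp add: T_def transpose_def vec_eq_iff forall_sum_type)
  have root_column_bound: "\<bar>u \<bullet> (msqrt M *v axis i 1)\<bar>\<^sup>2 \<le> u \<bullet> (M *v u)"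
    if "M \<in> psd_mats" for M :: "real^'n^'n" and u i
  proof -
    note root = msqrt_psd[OF that] msqrt_square[OF that]
    have "u \<bullet> (M *v u) = u \<bullet> (msqrt M *v (msqrt M *v u))"
      by (simp add: matrix_vector_mul_assoc root)
    also have "\<dots> = (msqrt M *v u) \<bullet> (msqrt M *v u)"
      using inner_symmetric_mult[OF psd_matsD(1)[OF root(1)]] by simp
    finally have "u \<bullet> (M *v u) = (norm (msqrt M *v u))\<^sup>2"
      by (simp add: dot_square_norm)
    moreover have "\<bar>u \<bullet> (msqrt M *v axis i 1)\<bar> \<le> norm (msqrt M *v u)"
      using inner_symmetric_mult[OF psd_matsD(1)[OF root(1)], of u "axis i 1"]
        Cauchy_Schwarz_ineq2[of "msqrt M *v u" "axis i 1"] by simp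
    ultimately show ?thesis
      using power_mono[of "\<bar>u \<bullet> (msqrt M *v axis i 1)\<bar>" "norm (msqrt M *v u)" 2] by simp
  qed
  have "0 \<le> u \<bullet> (S1 *v u) + w \<bullet> (S2 *v w) + 2 * (u \<bullet> (upper_right T *v w))" for u w
  proof -
    have "upper_right T *v w = (y \<bullet> w) *\<^sub>R x"
      by (simp add: blocks matrix_vector_mult_def vec_eq_iff inner_vec_def sum_distrib_left
          sum_distrib_right mult_ac)
    then have "u \<bullet> (upper_right T *v w) = (u \<bullet> x) * (w \<bullet> y)"
      by (simp add: inner_commute)
    moreover have "(u \<bullet> x)\<^sup>2 \<le> u \<bullet> (S1 *v u)" "(w \<bullet> y)\<^sup>2 \<le> w \<bullet> (S2 *v w)"
      using root_column_bound[OF S1(1), of u k] root_column_bound[OF S2(1), of w l] by (simp_all add: x_def y_def)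
    moreover have "0 \<le> (u \<bullet> x + w \<bullet> y)\<^sup>2" by simp
    ultimately show ?thesis by (simp add: power2_sum)
  qed
  then have "T \<in> couplings S1 S2"
    using \<open>transpose T = T\<close> by (simp add: couplings_def psd_blocks_iff blocks)
  moreover have "T \<noteq> block_diag S1 S2"
  proof
    assume "T = block_diag S1 S2"
    then have "upper_right T = 0" by simp
    then have "x $ i * y $ j = 0" for i j
      by (auto simp: blocks vec_eq_iff)
    then have "x = 0 \<or> y = 0"
      by (metis mult_eq_0_iff vec_eq_iff zero_index)
    then show False
      using k l by (simp add: x_def y_def)
  qed
  ultimately show ?thesis by (rule that)
qed

text \<open>One inclusion holds for arbitrary matrices \<open>A\<close>, \<open>B\<close>; applied to their transposes it gives the
  other one, as conjugation by the transpose undoes conjugation by an orthogonal matrix.\<close>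

lemma couplings_orthogonal_conj:
  assumes A: "orthogonal_matrix A" and B: "orthogonal_matrix B"
  shows "couplings (A ** S1 ** transpose A) (B ** S2 ** transpose B)
    = (\<lambda>T. block_diag A B ** T ** transpose (block_diag A B)) ` couplings S1 S2"
proof -
  have sub: "(\<lambda>T. block_diag A B ** T ** transpose (block_diag A B)) ` couplings S1 S2
      \<subseteq> couplings (A ** S1 ** transpose A) (B ** S2 ** transpose B)" for A B S1 S2
    by (auto simp: couplings_def psd_conj blocks_of_block_diag_conj)
  show ?thesis
  proof
    let ?O = "block_diag A B"
    show "couplings (A ** S1 ** transpose A) (B ** S2 ** transpose B)
        \<subseteq> (\<lambda>T. ?O ** T ** transpose ?O) ` couplings S1 S2"
    proof
      fix T assume "T \<in> couplings (A ** S1 ** transpose A) (B ** S2 ** transpose B)"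
      then have "transpose ?O ** T ** ?O \<in> couplings
          (transpose A ** (A ** S1 ** transpose A) ** transpose (transpose A))
          (transpose B ** (B ** S2 ** transpose B) ** transpose (transpose B))"
        using sub[of "transpose A" "transpose B"] by (force simp: transpose_block_diag)
      then have "transpose ?O ** T ** ?O \<in> couplings S1 S2"
        by (simp only: transpose_transpose orthogonal_conj_cancel[OF A] orthogonal_conj_cancel[OF B])
      moreover have "T = ?O ** (transpose ?O ** T ** ?O) ** transpose ?O"
        using orthogonal_conj_cancel[of "transpose ?O" T] orthogonal_block_diag[OF A B]
        by simp
      ultimately show "T \<in> (\<lambda>T. ?O ** T ** transpose ?O) ` couplings S1 S2"
        by blast
    qed
  qed (rule sub)
qed

section \<open>The dependence coefficients\<close>

text \<open>The value of \<open>f\<close> at \<open>T1\<close> exceeds \<open>c\<close>, hence so does its maximum, and the quotient is an affine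
  rescaling of \<open>f\<close> with positive slope that maps \<open>c\<close> to \<open>0\<close> and the maximum to \<open>1\<close>.\<close>

lemma normalized_by_maximum:
  fixes f :: "'a::topological_space \<Rightarrow> real"
  assumes K: "compact K" "continuous_on K f"
    and ge: "\<And>T. T \<in> K \<Longrightarrow> c \<le> f T" and eq: "\<And>T. T \<in> K \<Longrightarrow> f T = c \<longleftrightarrow> T = T0"
    and T1: "T1 \<in> K" "T1 \<noteq> T0" and S: "S \<in> K"
  defines "D \<equiv> \<lambda>T. (f T - c) / ((SUP T\<in>K. f T) - c)"
  shows "D S \<in> {0..1}" "D S = 0 \<longleftrightarrow> S = T0" "\<exists>T\<in>K. D T = 1"
proof -
  have "K \<noteq> {}" using S by blast
  then obtain M where M: "M \<in> K" "\<And>T. T \<in> K \<Longrightarrow> f T \<le> f M"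
    using continuous_attains_sup[OF K(1) _ K(2)] by blast
  then have sup: "(SUP T\<in>K. f T) = f M"
    by (intro cSup_eq_maximum) auto
  have "c < f M"
    using M(2)[OF T1(1)] ge[OF T1(1)] eq[OF T1(1)] T1(2) by linarith
  then show "D S \<in> {0..1}" "D S = 0 \<longleftrightarrow> S = T0" "\<exists>T\<in>K. D T = 1"
    using ge[OF S] M eq[OF S] S by (auto simp: D_def sup divide_simps intro!: bexI[of _ M])
qed

lemma
  assumes "T \<in> couplings S1 S2"
  shows bw_dist_sq_mat_1_ge_blocks:
      "bw_dist_sq S1 (mat 1) + bw_dist_sq S2 (mat 1) \<le> bw_dist_sq T (mat 1)"
    and bw_dist_sq_mat_1_eq_blocks_iff:
      "bw_dist_sq T (mat 1) = bw_dist_sq S1 (mat 1) + bw_dist_sq S2 (mat 1) \<longleftrightarrow> T = block_diag S1 S2"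
proof -
  note T = couplingsD[OF assms]
  have psd: "S1 \<in> psd_mats" "S2 \<in> psd_mats"
    using psd_upper_left[OF T(1)] psd_lower_right[OF T(1)] T by simp_all
  have "trace (mat 1 :: real^('a + 'b)^('a + 'b)) = trace (mat 1 :: real^'a^'a) + trace (mat 1 :: real^'b^'b)"
    unfolding block_diag_mat_1[symmetric] by (simp add: trace_blocks[of "block_diag _ _"])
  then have "bw_dist_sq T (mat 1) - (bw_dist_sq S1 (mat 1) + bw_dist_sq S2 (mat 1))
      = 2 * (trace (msqrt S1) + trace (msqrt S2) - trace (msqrt T))"
    using trace_blocks[of T] by (simp add: bw_dist_sq_mat_1 psd T)
  then show "bw_dist_sq S1 (mat 1) + bw_dist_sq S2 (mat 1) \<le> bw_dist_sq T (mat 1)"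
    and "bw_dist_sq T (mat 1) = bw_dist_sq S1 (mat 1) + bw_dist_sq S2 (mat 1) \<longleftrightarrow> T = block_diag S1 S2"
    using trace_msqrt_le_blocks[OF T(1)] trace_msqrt_eq_blocks_iff[OF T(1)]
    unfolding T by auto
qed

lemma wdep1_coupling:
  assumes "T \<in> couplings S1 S2"
  shows "wdep1 T = (bw_dist_sq T (mat 1) - (bw_dist_sq S1 (mat 1) + bw_dist_sq S2 (mat 1))) /
    ((SUP T\<in>couplings S1 S2. bw_dist_sq T (mat 1))
       - (bw_dist_sq S1 (mat 1) + bw_dist_sq S2 (mat 1)))"
  using couplingsD[OF assms] by (simp add: wdep1_def Let_def diff_diff_eq)

text \<open>The subtracted zeros bring the coefficient into the form of \<open>normalized_by_maximum\<close>.\<close>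

lemma wdep2_coupling:
  assumes "T \<in> couplings S1 S2"
  shows "wdep2 T = (bw_dist_sq T (block_diag S1 S2) - 0) /
    ((SUP T\<in>couplings S1 S2. bw_dist_sq T (block_diag S1 S2)) - 0)"
  using couplingsD[OF assms] by (simp add: wdep2_def Let_def)

lemma
  assumes S: "S \<in> couplings S1 S2" and A: "orthogonal_matrix A" and B: "orthogonal_matrix B"
  defines "U \<equiv> block_diag A B"
  shows wdep1_orthogonal_conj: "wdep1 (U ** S ** transpose U) = wdep1 S"
    and wdep2_orthogonal_conj: "wdep2 (U ** S ** transpose U) = wdep2 S"
proof -
  let ?S1 = "A ** S1 ** transpose A" and ?S2 = "B ** S2 ** transpose B"
  note T = couplingsD[OF S]
  have psd: "S1 \<in> psd_mats" "S2 \<in> psd_mats"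
    using psd_upper_left[OF T(1)] psd_lower_right[OF T(1)] T by simp_all
  have U: "orthogonal_matrix U"
    unfolding U_def by (rule orthogonal_block_diag[OF A B])
  have img: "couplings ?S1 ?S2 = (\<lambda>T. U ** T ** transpose U) ` couplings S1 S2"
    unfolding U_def by (rule couplings_orthogonal_conj[OF A B])
  then have S': "U ** S ** transpose U \<in> couplings ?S1 ?S2"
    using S by blast
  have conj_1: "bw_dist_sq (V ** M ** transpose V) (mat 1) = bw_dist_sq M (mat 1)"
    if "orthogonal_matrix V" "M \<in> psd_mats" for V M :: "real^'n^'n"
  proof -
    have "V ** mat 1 ** transpose V = mat 1"
      using that(1) by (simp add: orthogonal_matrix_def)
    then show ?thesis
      using bw_dist_sq_orthogonal_conj[OF that(2) psd_mat_1 that(1)] by simp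
  qed
  have "(SUP T\<in>couplings ?S1 ?S2. bw_dist_sq T (mat 1))
      = (SUP T\<in>couplings S1 S2. bw_dist_sq T (mat 1))"
    unfolding img image_image by (intro SUP_cong) (auto simp: conj_1 U couplingsD)
  then show "wdep1 (U ** S ** transpose U) = wdep1 S"
    by (simp add: wdep1_coupling[OF S] wdep1_coupling[OF S'] conj_1 U A B T psd)
  have "block_diag ?S1 ?S2 = U ** block_diag S1 S2 ** transpose U"
    by (simp add: U_def transpose_block_diag block_diag_mult)
  then have conj_0: "bw_dist_sq (U ** M ** transpose U) (block_diag ?S1 ?S2)
      = bw_dist_sq M (block_diag S1 S2)" if "M \<in> psd_mats" for M
    using bw_dist_sq_orthogonal_conj[OF that psd_block_diag[OF psd] U] by simp
  have "(SUP T\<in>couplings ?S1 ?S2. bw_dist_sq T (block_diag ?S1 ?S2))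
      = (SUP T\<in>couplings S1 S2. bw_dist_sq T (block_diag S1 S2))"
    unfolding img image_image by (intro SUP_cong) (auto simp: conj_0 couplingsD)
  then show "wdep2 (U ** S ** transpose U) = wdep2 S"
    by (simp add: wdep2_coupling[OF S] wdep2_coupling[OF S'] conj_0 T)
qed

theorem proposition3p3:
  fixes S :: "real^('p::finite + 'q::finite)^('p + 'q)"
    and S1 :: "real^'p^'p" and S2 :: "real^'q^'q"
  assumes "S1 \<in> psd_mats" and "S1 \<noteq> 0"
    and "S2 \<in> psd_mats" and "S2 \<noteq> 0"
    and "S \<in> couplings S1 S2"
  shows "\<forall>D \<in> {wdep1, wdep2}.
      (D S \<in> {0..1} \<and> (D S = 0 \<longleftrightarrow> S = block_diag S1 S2)) \<and>
      (\<exists>T \<in> couplings S1 S2. D T = 1) \<and>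
      (\<forall>(O1 :: real^'p^'p) (O2 :: real^'q^'q).
         orthogonal_matrix O1 \<longrightarrow> orthogonal_matrix O2 \<longrightarrow>
         D (block_diag O1 O2 ** S ** transpose (block_diag O1 O2)) = D S)"
proof -
  let ?K = "couplings S1 S2" and ?S0 = "block_diag S1 S2"
  obtain T1 where T1: "T1 \<in> ?K" "T1 \<noteq> ?S0"
    using dependent_coupling_exists assms(1-4) by blast
  have psd: "?K \<subseteq> psd_mats"
    by (auto simp: couplingsD)
  have S0: "?S0 \<in> psd_mats"
    by (rule psd_block_diag[OF assms(1,3)])
  note cont = continuous_on_bw_dist_sq[OF compact_couplings psd]
  note D1 = normalized_by_maximum[OF compact_couplings cont[OF psd_mat_1]
      bw_dist_sq_mat_1_ge_blocks bw_dist_sq_mat_1_eq_blocks_iff T1 assms(5),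
      folded wdep1_coupling[OF assms(5)]]
  have "0 \<le> bw_dist_sq T ?S0" "bw_dist_sq T ?S0 = 0 \<longleftrightarrow> T = ?S0" if "T \<in> ?K" for T
    using that psd S0 by (auto intro: bw_dist_sq_nonneg simp: bw_dist_sq_eq_0_iff subset_iff)
  note D2 = normalized_by_maximum[OF compact_couplings cont[OF S0] this T1 assms(5),
      folded wdep2_coupling[OF assms(5)]]
  have "\<exists>T\<in>?K. wdep1 T = 1"
    using D1(3) by (simp add: wdep1_coupling cong: bex_cong)
  moreover have "\<exists>T\<in>?K. wdep2 T = 1"
    using D2(3) by (simp add: wdep2_coupling cong: bex_cong)
  ultimately show ?thesis
    using D1 D2 wdep1_orthogonal_conj[OF assms(5)] wdep2_orthogonal_conj[OF assms(5)] by simp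
qed

end
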